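(* For every $n\ge1$, the interlace polynomial takes at least $n$ linearly independent values on the subspace of primitive elements of degree $n$ of the Hopf algebra of binary delta-matroids; equivalently, among the polynomials $q_{\Delta}(\pi(D),x)$, where $D$ ranges over binary delta-matroids with an $n$-element ground set, there are $n$ that are linearly independent.
   Context: A set system is $(E,\Phi)$ with $E$ finite and $\emptyset\ne\Phi\subseteq 2^E$. A delta-matroid is a set system such that for all $X,Y\in\Phi$ and $x\in X\Delta Y$ there is $y\in X\Delta Y$ with $\{x,y\}\Delta X\in\Phi$. Twist: $D*X=(E,\{F\Delta X:F\in\Phi\})$. For symmetric $A$ over $\mathbb{F}_2$ indexed by $E$, $M_A=(E,\{X: A[X]\text{ nondegenerate}\})$ (empty matrix nondegenerate); binary delta-matroids are twists of such $M_A$. Let $\mathcal{B}=\bigoplus_k\mathcal{B}_k$ be the vector space over $\mathbb{C}$ freely spanned by binary delta-matroids, graded by the size of the ground set, with product $(E_1,\Phi_1)(E_2,\Phi_2)=(E_1\sqcup E_2,\{\phi_1\sqcup\phi_2:\phi_i\in\Phi_i\})$ and coproduct $\mu(D)=\sum_{E'\subseteq E}D_{E'}\otimes D_{E\setminus E'}$, where $D_{E'}=(E',\{F\in\Phi:F\subseteq E'\})$; $p$ is primitive if $\mu(p)=1\otimes p+p\otimes 1$. The projection of $\mathcal{B}_n$ onto its primitive subspace is $\pi(D)=\sum_{k\ge1}(-1)^{k-1}(k-1)!\sum D_{E_1}\cdots D_{E_k}$, summed over unordered partitions of $E$ into $k$ nonempty blocks. The interlace polynomial $q_{\Delta}(D,x)=\sum_{\phi\subseteq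 E}x^{d_D(\phi)}$, $d_D(X)=\min_{F\in\Phi}|F\Delta X|$, is extended linearly to $\mathcal{B}$.
   Formalization: When no feasible set of D lies in E', the formula for D_{E'} gives an empty family, which is not a set system; in that case D_{E'} is taken to consist of the sets F∩E' for feasible F with |F∖E'| minimal (coloop deletion). Delta-matroids are taken up to isomorphism. *)

theory Defs
  imports
    Complex_Main
    "HOL-Library.Z2"
    "HOL-Library.Nat_Bijection"
    "HOL-Library.Disjoint_Sets"
    "HOL-Library.Poly_Mapping"
    "HOL-Combinatorics.Permutations"
    "HOL-Computational_Algebra.Polynomial"
begin

section \<open>Set systems and binary delta-matroids\<close>

definition set_system :: "'a set \<times> 'a set set \<Rightarrow> bool" where
  "set_system D \<longleftrightarrow> finite (fst D) \<and> snd D \<noteq> {} \<and> snd D \<subseteq> Pow (fst D)"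

definition twist :: "'a set \<times> 'a set set \<Rightarrow> 'a set \<Rightarrow> 'a set \<times> 'a set set" where
  "twist D X = (fst D, (\<lambda>F. sym_diff F X) ` snd D)"

text \<open>The determinant of the principal submatrix on a finite index set \<open>X\<close>, given by the Leibniz
  formula; it is \<open>1\<close> for \<open>X = {}\<close>.\<close>

definition principal_minor :: "('a \<Rightarrow> 'a \<Rightarrow> 'b::comm_ring_1) \<Rightarrow> 'a set \<Rightarrow> 'b" where
  "principal_minor A X = (\<Sum>p | p permutes X. of_int (sign p) * (\<Prod>i\<in>X. A i (p i)))"

definition matrix_system :: "'a set \<Rightarrow> ('a \<Rightarrow> 'a \<Rightarrow> bit) \<Rightarrow> 'a set \<times> 'a set set" where
  "matrix_system E A = (E, {X. X \<subseteq> E \<and> principal_minor A X \<noteq> 0})"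

definition binary_delta_matroid :: "'a set \<times> 'a set set \<Rightarrow> bool" where
  "binary_delta_matroid D \<longleftrightarrow> finite (fst D) \<and>
     (\<exists>A X. (\<forall>i\<in>fst D. \<forall>j\<in>fst D. A i j = A j i) \<and> X \<subseteq> fst D \<and>
            D = twist (matrix_system (fst D) A) X)"

lemma set_system_binary:
  assumes "binary_delta_matroid D" shows "set_system D"
proof -
  obtain A X where fin: "finite (fst D)" and X: "X \<subseteq> fst D"
    and D: "D = twist (matrix_system (fst D) A) X"
    using assms by (auto simp: binary_delta_matroid_def)
  have snd: "snd D = (\<lambda>F. sym_diff F X) ` {Y. Y \<subseteq> fst D \<and> principal_minor A Y \<noteq> 0}"
    using arg_cong[OF D, of snd] by (simp only: twist_def matrix_system_def fst_conv snd_conv)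
  have "principal_minor A {} \<noteq> 0" by (simp add: principal_minor_def)
  then have "snd D \<noteq> {}" by (auto simp only: snd image_is_empty Collect_empty_eq)
  moreover have "snd D \<subseteq> Pow (fst D)" unfolding snd using X by blast
  ultimately show ?thesis using fin by (simp add: set_system_def)
qed

text \<open>If some feasible set lies in \<open>E'\<close>, the feasible sets of the restriction to \<open>E'\<close> are exactly
  those contained in \<open>E'\<close>. Otherwise that family is empty, which is not a set system, and the usual
  delta-matroid convention for deleting coloops applies: the feasible sets having the fewest elements
  outside \<open>E'\<close> are intersected with \<open>E'\<close>. In particular the restriction to \<open>{}\<close> is always the
  unit \<open>({}, {{}})\<close>. For delta-matroids this is the result of deleting the elements outside \<open>E'\<close>
  one after the other, in any order, where deleting a coloop \<open>e\<close> removes \<open>e\<close> from every feasible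
  set.\<close>

definition restriction :: "'a set \<times> 'a set set \<Rightarrow> 'a set \<Rightarrow> 'a set \<times> 'a set set" where
  "restriction D E' = (E',
     if \<exists>F\<in>snd D. F \<subseteq> E' then {F \<in> snd D. F \<subseteq> E'}
     else {F \<inter> E' | F. F \<in> snd D \<and> (\<forall>G\<in>snd D. card (F - E') \<le> card (G - E'))})"

definition distance :: "'a set \<times> 'a set set \<Rightarrow> 'a set \<Rightarrow> nat" where
  "distance D X = Min ((\<lambda>F. card (sym_diff F X)) ` snd D)"

definition interlace_poly :: "'a set \<times> 'a set set \<Rightarrow> complex poly" where
  "interlace_poly D = (\<Sum>X\<in>Pow (fst D). monom 1 (distance D X))"

section \<open>Isomorphism classes\<close>

definition ss_iso :: "'a set \<times> 'a set set \<Rightarrow> 'b set \<times> 'b set set \<Rightarrow> bool" where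
  "ss_iso D D' \<longleftrightarrow> (\<exists>f. bij_betw f (fst D) (fst D') \<and> snd D' = (\<lambda>F. f ` F) ` snd D)"

lemma ss_iso_refl: "ss_iso D D"
  unfolding ss_iso_def by (rule exI[of _ "\<lambda>x. x"]) (auto simp: bij_betw_def)

lemma ss_iso_sym:
  assumes "set_system D" "ss_iso D D'" shows "ss_iso D' D"
proof -
  obtain f where f: "bij_betw f (fst D) (fst D')" "snd D' = (\<lambda>F. f ` F) ` snd D"
    using assms(2) by (auto simp: ss_iso_def)
  let ?g = "inv_into (fst D) f"
  have inj: "inj_on f (fst D)" using f(1) by (simp add: bij_betw_def)
  have "?g ` f ` F = F" if "F \<in> snd D" for F
    using that assms(1) inv_into_image_cancel[OF inj, of F] by (auto simp: set_system_def)
  then have "(\<lambda>F. ?g ` F) ` snd D' = snd D"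
    by (force simp: f(2) image_image)
  then show ?thesis
    unfolding ss_iso_def using bij_betw_inv_into[OF f(1)] by metis
qed

lemma ss_iso_trans:
  assumes "ss_iso D D'" "ss_iso D' D''" shows "ss_iso D D''"
proof -
  obtain f where f: "bij_betw f (fst D) (fst D')" "snd D' = (\<lambda>F. f ` F) ` snd D"
    using assms(1) by (auto simp: ss_iso_def)
  obtain g where g: "bij_betw g (fst D') (fst D'')" "snd D'' = (\<lambda>F. g ` F) ` snd D'"
    using assms(2) by (auto simp: ss_iso_def)
  have "snd D'' = (\<lambda>F. (g \<circ> f) ` F) ` snd D"
    by (simp add: f(2) g(2) image_image image_comp)
  then show ?thesis
    unfolding ss_iso_def using bij_betw_trans[OF f(1) g(1)] by blast
qed

text \<open>Every finite set system has an isomorphic copy with ground set in \<open>nat\<close>.\<close>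

quotient_type ss_class = "nat set \<times> nat set set" / partial:
  "\<lambda>D D'. set_system D \<and> set_system D' \<and> ss_iso D D'"
proof (rule part_equivpI)
  show "\<exists>D :: nat set \<times> nat set set. set_system D \<and> set_system D \<and> ss_iso D D"
    by (rule exI[of _ "({}, {{}})"]) (simp add: set_system_def ss_iso_refl)
  show "symp (\<lambda>D D' :: nat set \<times> nat set set. set_system D \<and> set_system D' \<and> ss_iso D D')"
    by (auto intro!: sympI dest: ss_iso_sym)
  show "transp (\<lambda>D D' :: nat set \<times> nat set set. set_system D \<and> set_system D' \<and> ss_iso D D')"
    by (auto intro!: transpI dest: ss_iso_trans)
qed

section \<open>The monoid of isomorphism classes\<close>

definition disjoint_sum ::
    "nat set \<times> nat set set \<Rightarrow> nat set \<times> nat set set \<Rightarrow> nat set \<times> nat set set" where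
  "disjoint_sum D1 D2 =
     (sum_encode ` (fst D1 <+> fst D2),
      {sum_encode ` (F1 <+> F2) | F1 F2. F1 \<in> snd D1 \<and> F2 \<in> snd D2})"

lemma set_system_disjoint_sum:
  assumes "set_system D1" "set_system D2" shows "set_system (disjoint_sum D1 D2)"
  using assms unfolding set_system_def disjoint_sum_def by (fastforce simp: Plus_def)

lemma ss_iso_disjoint_sum:
  assumes "ss_iso D1 D1'" "ss_iso D2 D2'"
  shows "ss_iso (disjoint_sum D1 D2) (disjoint_sum D1' D2')"
proof -
  obtain f where f: "bij_betw f (fst D1) (fst D1')" "snd D1' = (\<lambda>F. f ` F) ` snd D1"
    using assms(1) by (auto simp: ss_iso_def)
  obtain g where g: "bij_betw g (fst D2) (fst D2')" "snd D2' = (\<lambda>F. g ` F) ` snd D2"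
    using assms(2) by (auto simp: ss_iso_def)
  define h where "h = (\<lambda>z. sum_encode (map_sum f g (sum_decode z)))"
  have h: "h ` sum_encode ` (A <+> B) = sum_encode ` (f ` A <+> g ` B)" for A B
    by (auto simp: h_def image_image Plus_def image_Un)
  have "inj_on h (sum_encode ` (fst D1 <+> fst D2))"
    by (rule inj_onI)
      (auto simp: h_def sum_encode_eq dest: inj_onD[OF bij_betw_imp_inj_on[OF f(1)]]
        inj_onD[OF bij_betw_imp_inj_on[OF g(1)]])
  then have "bij_betw h (fst (disjoint_sum D1 D2)) (fst (disjoint_sum D1' D2'))"
    using f(1) g(1) by (simp add: bij_betw_def disjoint_sum_def h)
  moreover have "snd (disjoint_sum D1' D2') = (\<lambda>F. h ` F) ` snd (disjoint_sum D1 D2)"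
  proof -
    have "snd (disjoint_sum D1' D2')
        = {h ` sum_encode ` (F1 <+> F2) | F1 F2. F1 \<in> snd D1 \<and> F2 \<in> snd D2}"
      unfolding disjoint_sum_def h f(2) g(2) by auto
    also have "\<dots> = (\<lambda>F. h ` F) ` snd (disjoint_sum D1 D2)"
      unfolding disjoint_sum_def by (simp only: fst_conv snd_conv) blast
    finally show ?thesis .
  qed
  ultimately show ?thesis unfolding ss_iso_def by blast
qed

lemma ss_iso_disjoint_sum_assoc:
  "ss_iso (disjoint_sum (disjoint_sum D1 D2) D3) (disjoint_sum D1 (disjoint_sum D2 D3))"
proof -
  define h where "h = (\<lambda>z. case sum_decode z of
      Inl y \<Rightarrow> (case sum_decode y of Inl a \<Rightarrow> sum_encode (Inl a)
                | Inr b \<Rightarrow> sum_encode (Inr (sum_encode (Inl b))))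
    | Inr c \<Rightarrow> sum_encode (Inr (sum_encode (Inr c))))"
  have h: "h ` sum_encode ` (sum_encode ` (A <+> B) <+> C)
         = sum_encode ` (A <+> sum_encode ` (B <+> C))" for A B C
    by (simp add: h_def image_image Plus_def image_Un Un_assoc)
  have "inj_on h (sum_encode ` (sum_encode ` (fst D1 <+> fst D2) <+> fst D3))"
    by (auto simp: h_def inj_on_def sum_encode_eq)
  then have "bij_betw h (fst (disjoint_sum (disjoint_sum D1 D2) D3))
                        (fst (disjoint_sum D1 (disjoint_sum D2 D3)))"
    by (simp add: bij_betw_def disjoint_sum_def h)
  moreover have "snd (disjoint_sum D1 (disjoint_sum D2 D3))
               = (\<lambda>F. h ` F) ` snd (disjoint_sum (disjoint_sum D1 D2) D3)"
  proof -
    have "snd (disjoint_sum D1 (disjoint_sum D2 D3))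
        = {h ` sum_encode ` (sum_encode ` (F1 <+> F2) <+> F3) | F1 F2 F3.
             F1 \<in> snd D1 \<and> F2 \<in> snd D2 \<and> F3 \<in> snd D3}"
      unfolding disjoint_sum_def h by auto
    also have "\<dots> = (\<lambda>F. h ` F) ` snd (disjoint_sum (disjoint_sum D1 D2) D3)"
      unfolding disjoint_sum_def by (simp only: fst_conv snd_conv) blast
    finally show ?thesis .
  qed
  ultimately show ?thesis unfolding ss_iso_def by blast
qed

lemma ss_iso_disjoint_sum_commute: "ss_iso (disjoint_sum D1 D2) (disjoint_sum D2 D1)"
proof -
  define h where "h = (\<lambda>z. case sum_decode z of
      Inl a \<Rightarrow> sum_encode (Inr a) | Inr b \<Rightarrow> sum_encode (Inl b))"
  have h: "h ` sum_encode ` (A <+> B) = sum_encode ` (B <+> A)" for A B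
    by (simp add: h_def image_image Plus_def image_Un Un_commute)
  have "inj_on h (sum_encode ` (fst D1 <+> fst D2))"
    by (auto simp: h_def inj_on_def sum_encode_eq)
  then have "bij_betw h (fst (disjoint_sum D1 D2)) (fst (disjoint_sum D2 D1))"
    by (simp add: bij_betw_def disjoint_sum_def h)
  moreover have "snd (disjoint_sum D2 D1) = (\<lambda>F. h ` F) ` snd (disjoint_sum D1 D2)"
  proof -
    have "snd (disjoint_sum D2 D1)
        = {h ` sum_encode ` (F1 <+> F2) | F1 F2. F1 \<in> snd D1 \<and> F2 \<in> snd D2}"
      unfolding disjoint_sum_def h by auto
    also have "\<dots> = (\<lambda>F. h ` F) ` snd (disjoint_sum D1 D2)"
      unfolding disjoint_sum_def by (simp only: fst_conv snd_conv) blast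
    finally show ?thesis .
  qed
  ultimately show ?thesis unfolding ss_iso_def by blast
qed

lemma ss_iso_disjoint_sum_empty: "ss_iso (disjoint_sum ({}, {{}}) D) D"
proof -
  define h where "h = (\<lambda>z. case sum_decode z of Inl a \<Rightarrow> a | Inr b \<Rightarrow> b)"
  have h: "h ` sum_encode ` ({} <+> B) = B" for B
    by (simp add: h_def image_image Plus_def)
  have "inj_on h (sum_encode ` ({} <+> fst D))"
    by (auto simp: h_def inj_on_def sum_encode_eq)
  then have "bij_betw h (fst (disjoint_sum ({}, {{}}) D)) (fst D)"
    by (simp add: bij_betw_def disjoint_sum_def h)
  moreover have "snd D = (\<lambda>F. h ` F) ` snd (disjoint_sum ({}, {{}}) D)"
  proof -
    have "snd (disjoint_sum ({}, {{}}) D) = (\<lambda>F. sum_encode ` ({} <+> F)) ` snd D"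
      by (auto simp: disjoint_sum_def)
    then show ?thesis by (simp only: image_image[of "\<lambda>F. h ` F"] h) simp
  qed
  ultimately show ?thesis unfolding ss_iso_def by blast
qed

instantiation ss_class :: comm_monoid_add
begin

lift_definition zero_ss_class :: ss_class is "({}, {{}})"
  by (simp add: set_system_def ss_iso_refl)

lift_definition plus_ss_class :: "ss_class \<Rightarrow> ss_class \<Rightarrow> ss_class" is disjoint_sum
  by (simp add: set_system_disjoint_sum ss_iso_disjoint_sum)

instance
proof
  fix a b c :: ss_class
  show "a + b + c = a + (b + c)"
    by transfer (simp add: set_system_disjoint_sum ss_iso_disjoint_sum_assoc)
  show "a + b = b + a"
    by transfer (simp add: set_system_disjoint_sum ss_iso_disjoint_sum_commute)
  show "0 + a = a"
    by transfer (simp add: ss_iso_disjoint_sum_empty set_system_disjoint_sum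
        set_system_def[of "({}, {{}})"])
qed

end

section \<open>Invariance under isomorphism\<close>

lemma set_system_restriction:
  assumes "set_system D" "E' \<subseteq> fst D" shows "set_system (restriction D E')"
proof -
  have fin: "finite (snd D)" "snd D \<noteq> {}"
    using assms(1) finite_subset[of "snd D" "Pow (fst D)"] by (simp_all add: set_system_def)
  obtain F where "F \<in> snd D" "\<forall>G\<in>snd D. card (F - E') \<le> card (G - E')"
    using ex_is_arg_min_if_finite[OF fin, of "\<lambda>F. card (F - E')"]
    by (auto simp: is_arg_min_linorder)
  then show ?thesis
    using assms finite_subset[OF assms(2)] unfolding set_system_def restriction_def by auto
qed

lemma ss_iso_restriction:
  assumes D: "set_system D" and E': "E' \<subseteq> fst D"
    and f: "bij_betw f (fst D) (fst D')" "snd D' = (\<lambda>F. f ` F) ` snd D"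
  shows "ss_iso (restriction D E') (restriction D' (f ` E'))"
proof -
  have inj: "inj_on f (fst D)" using f(1) by (simp add: bij_betw_def)
  have sub: "F \<subseteq> fst D" if "F \<in> snd D" for F using that D by (auto simp: set_system_def)
  have le: "f ` F \<subseteq> f ` E' \<longleftrightarrow> F \<subseteq> E'" if "F \<in> snd D" for F
    using inj_on_image_mem_iff[OF inj _ E'] sub[OF that] by blast
  have int: "f ` F \<inter> f ` E' = f ` (F \<inter> E')" if "F \<in> snd D" for F
    using inj_on_image_Int[OF inj sub[OF that] E'] by simp
  have diff: "card (f ` F - f ` E') = card (F - E')" if "F \<in> snd D" for F
  proof -
    have "f ` F - f ` E' = f ` (F - E')"
      using inj_on_image_set_diff[OF inj, of F E'] sub[OF that] E' by auto
    moreover have "inj_on f (F - E')" using inj sub[OF that] by (auto intro: inj_on_subset)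
    ultimately show ?thesis by (simp add: card_image)
  qed
  have "bij_betw f E' (f ` E')"
    using inj E' by (auto simp: bij_betw_def intro: inj_on_subset)
  moreover have "snd (restriction D' (f ` E')) = (\<lambda>F. f ` F) ` snd (restriction D E')"
  proof (cases "\<exists>F\<in>snd D. F \<subseteq> E'")
    case True
    then have "\<exists>F\<in>snd D'. F \<subseteq> f ` E'" using le f(2) by auto
    then have "snd (restriction D' (f ` E')) = {F \<in> snd D'. F \<subseteq> f ` E'}"
      by (simp add: restriction_def)
    also have "\<dots> = (\<lambda>F. f ` F) ` {F \<in> snd D. F \<subseteq> E'}"
      using le by (auto simp: f(2))
    finally show ?thesis using True by (simp add: restriction_def)
  next
    case False
    then have F': "\<not> (\<exists>F\<in>snd D'. F \<subseteq> f ` E')" using le f(2) by auto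
    let ?P = "\<lambda>F. F \<in> snd D \<and> (\<forall>G\<in>snd D. card (F - E') \<le> card (G - E'))"
    have "snd (restriction D' (f ` E'))
        = {F \<inter> f ` E' | F. F \<in> snd D' \<and> (\<forall>G\<in>snd D'. card (F - f ` E') \<le> card (G - f ` E'))}"
      unfolding restriction_def snd_conv by (simp only: F' if_False)
    also have "\<dots> = {f ` F \<inter> f ` E' | F. F \<in> snd D \<and>
                      (\<forall>G\<in>snd D. card (f ` F - f ` E') \<le> card (f ` G - f ` E'))}"
      unfolding f(2) by blast
    also have "\<dots> = {f ` (F \<inter> E') | F. ?P F}"
      by (intro Collect_cong ex_cong1) (metis int diff)
    also have "\<dots> = (\<lambda>F. f ` F) ` {F \<inter> E' | F. ?P F}"
      by blast
    also have "\<dots> = (\<lambda>F. f ` F) ` snd (restriction D E')"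
      unfolding restriction_def snd_conv by (simp only: False if_False)
    finally show ?thesis .
  qed
  ultimately show ?thesis unfolding ss_iso_def by (auto simp: restriction_def)
qed

lemma interlace_poly_iso:
  assumes D: "set_system D" and iso: "ss_iso D D'"
  shows "interlace_poly D = interlace_poly D'"
proof -
  obtain f where f: "bij_betw f (fst D) (fst D')" "snd D' = (\<lambda>F. f ` F) ` snd D"
    using iso by (auto simp: ss_iso_def)
  have inj: "inj_on f (fst D)" using f(1) by (simp add: bij_betw_def)
  have "distance D' (f ` X) = distance D X" if X: "X \<subseteq> fst D" for X
  proof -
    have "card (sym_diff (f ` F) (f ` X)) = card (sym_diff F X)" if "F \<in> snd D" for F
    proof -
      have F: "F \<subseteq> fst D" using that D by (auto simp: set_system_def)
      have "sym_diff (f ` F) (f ` X) = f ` sym_diff F X"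
        using inj_on_image_set_diff[OF inj, of F X] inj_on_image_set_diff[OF inj, of X F] F X
        by (auto simp: image_Un)
      moreover have "inj_on f (sym_diff F X)" using inj F X by (auto intro: inj_on_subset)
      ultimately show ?thesis by (simp add: card_image)
    qed
    then show ?thesis by (simp add: distance_def f(2) image_image cong: image_cong)
  qed
  then have "interlace_poly D = (\<Sum>X\<in>Pow (fst D). monom 1 (distance D' (f ` X)))"
    unfolding interlace_poly_def by (intro sum.cong) auto
  also have "\<dots> = interlace_poly D'"
    unfolding interlace_poly_def
    by (rule sum.reindex_bij_betw[OF bij_betw_Pow[OF f(1)], of "\<lambda>X. monom 1 (distance D' X)"])
  finally show ?thesis .
qed

interpretation poly_space: vector_space "smult :: complex \<Rightarrow> complex poly \<Rightarrow> complex poly"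
  by unfold_locales (simp_all add: smult_add_right smult_add_left)

section \<open>The Hopf algebra\<close>

text \<open>The monoid algebra \<open>ss_class \<Rightarrow>\<^sub>0 complex\<close> is the algebra freely spanned by isomorphism classes of
  set systems; the space spanned by binary delta-matroids is a subspace of it, and the product of
  two basis elements is their disjoint sum. The tensor square of the space spanned by a basis is the
  space spanned by pairs of basis elements, so \<open>Poly_Mapping.single (c, d) 1\<close> represents
  \<open>c \<otimes> d\<close>.\<close>

definition ss_gen :: "nat set \<times> nat set set \<Rightarrow> ss_class \<Rightarrow>\<^sub>0 complex" where
  "ss_gen D = Poly_Mapping.single (abs_ss_class D) 1"

definition ss_coproduct ::
    "nat set \<times> nat set set \<Rightarrow> (ss_class \<times> ss_class) \<Rightarrow>\<^sub>0 complex" where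
  "ss_coproduct D = (\<Sum>E'\<in>Pow (fst D).
     Poly_Mapping.single
       (abs_ss_class (restriction D E'), abs_ss_class (restriction D (fst D - E'))) 1)"

lemma ss_coproduct_iso:
  assumes D: "set_system D" "set_system D'" and iso: "ss_iso D D'"
  shows "ss_coproduct D = ss_coproduct D'"
proof -
  obtain f where f: "bij_betw f (fst D) (fst D')" "snd D' = (\<lambda>F. f ` F) ` snd D"
    using iso by (auto simp: ss_iso_def)
  have inj: "inj_on f (fst D)" and im: "f ` fst D = fst D'"
    using f(1) by (auto simp: bij_betw_def)
  have cls: "abs_ss_class (restriction D X) = abs_ss_class (restriction D' (f ` X))"
    if X: "X \<subseteq> fst D" for X
  proof -
    have "f ` X \<subseteq> fst D'" using X im by blast
    then show ?thesis
      using ss_iso_restriction[OF D(1) X f] set_system_restriction[OF D(1) X]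
        set_system_restriction[OF D(2), of "f ` X"]
      by (simp add: Quotient3_rel_abs[OF Quotient3_ss_class])
  qed
  have compl: "f ` (fst D - X) = fst D' - f ` X" if "X \<subseteq> fst D" for X
    using inj_on_image_set_diff[OF inj, of "fst D" X] that im by auto
  let ?T = "\<lambda>Y. Poly_Mapping.single (abs_ss_class (restriction D' Y),
                abs_ss_class (restriction D' (fst D' - Y))) (1::complex)"
  have "ss_coproduct D = (\<Sum>X\<in>Pow (fst D). ?T (f ` X))"
    unfolding ss_coproduct_def by (intro sum.cong refl) (auto simp: cls compl)
  also have "\<dots> = ss_coproduct D'"
    unfolding ss_coproduct_def
    by (rule sum.reindex_bij_betw[OF bij_betw_Pow[OF f(1)], of ?T])
  finally show ?thesis .
qed

lift_definition class_coproduct :: "ss_class \<Rightarrow> (ss_class \<times> ss_class) \<Rightarrow>\<^sub>0 complex"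
  is ss_coproduct
  by (simp add: ss_coproduct_iso)

lift_definition class_interlace_poly :: "ss_class \<Rightarrow> complex poly" is interlace_poly
  by (auto dest: interlace_poly_iso)

definition coproduct :: "(ss_class \<Rightarrow>\<^sub>0 complex) \<Rightarrow> (ss_class \<times> ss_class) \<Rightarrow>\<^sub>0 complex" where
  "coproduct p = (\<Sum>c\<in>Poly_Mapping.keys p.
     Poly_Mapping.map (\<lambda>a. Poly_Mapping.lookup p c * a) (class_coproduct c))"

definition interlace :: "(ss_class \<Rightarrow>\<^sub>0 complex) \<Rightarrow> complex poly" where
  "interlace p = (\<Sum>c\<in>Poly_Mapping.keys p.
     smult (Poly_Mapping.lookup p c) (class_interlace_poly c))"

definition graded_part :: "nat \<Rightarrow> (ss_class \<Rightarrow>\<^sub>0 complex) set" where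
  "graded_part n = {p. \<forall>c\<in>Poly_Mapping.keys p.
     \<exists>D. binary_delta_matroid D \<and> card (fst D) = n \<and> c = abs_ss_class D}"

text \<open>The unit of the algebra is the basis element \<open>0 :: ss_class\<close>, the class of \<open>({}, {{}})\<close>; the two
  sums below are \<open>1 \<otimes> p\<close> and \<open>p \<otimes> 1\<close>.\<close>

definition primitive :: "(ss_class \<Rightarrow>\<^sub>0 complex) \<Rightarrow> bool" where
  "primitive p \<longleftrightarrow> coproduct p =
     (\<Sum>c\<in>Poly_Mapping.keys p. Poly_Mapping.single (0, c) (Poly_Mapping.lookup p c)) +
     (\<Sum>c\<in>Poly_Mapping.keys p. Poly_Mapping.single (c, 0) (Poly_Mapping.lookup p c))"

definition prim_proj :: "nat set \<times> nat set set \<Rightarrow> ss_class \<Rightarrow>\<^sub>0 complex" where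
  "prim_proj D = (\<Sum>k = 1..card (fst D). (-1) ^ (k - 1) * of_nat (fact (k - 1)) *
     (\<Sum>P | partition_on (fst D) P \<and> card P = k. \<Prod>B\<in>P. ss_gen (restriction D B)))"

end

theory Submission
  imports Defs
begin

text \<open>
  Let \<open>A\<close> be the adjacency matrix of a star with unlooped centre \<open>c\<close> and leaf set \<open>L\<close>, where the leaves
  in \<open>W\<close> carry loops and the other \<open>m\<close> leaves do not. A restriction of \<open>M\<^sub>A\<close> avoiding \<open>c\<close> is a product
  of one-element systems, so in \<open>\<pi>(M\<^sub>A)\<close> only the block containing \<open>c\<close> matters. Since
  \<open>(-1)\<^sup>k k!\<close> summed over the partitions of a \<open>j\<close>-set into \<open>k\<close> blocks gives \<open>(-1)\<^sup>j\<close>, the projection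
  \<open>\<pi>(M\<^sub>A)\<close> is the alternating sum, over \<open>B \<subseteq> L\<close>, of the stars in which only the leaves in \<open>B\<close>
  remain joined to \<open>c\<close>. Toggling the membership of one leaf in \<open>B\<close> cancels all mixed terms of the
  coproduct, whence primitivity. The same cancellation shows that the coefficient of \<open>x\<^sup>m\<^sup>+\<^sup>1\<close> in the
  interlace polynomial of this alternating sum is, up to sign, the number of even subsets of \<open>W\<close>,
  while no higher power of \<open>x\<close> occurs. With \<open>n\<close> vertices, \<open>m = 0, \<dots>, n - 1\<close> thus yields
  polynomials of degrees \<open>1, \<dots>, n\<close>.
\<close>

section \<open>Star systems\<close>

text \<open>The vertex \<open>c\<close> is the centre, \<open>W\<close> the set of looped vertices, \<open>B\<close> the set of neighbours of \<open>c\<close>.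
  Only the transpositions of \<open>c\<close> with a neighbour contribute to a principal minor containing \<open>c\<close>,
  which leads to \<open>star_feasible\<close>.\<close>

definition star_matrix :: "'a \<Rightarrow> 'a set \<Rightarrow> 'a set \<Rightarrow> 'a \<Rightarrow> 'a \<Rightarrow> bit" where
  "star_matrix c W B i j =
     of_bool (if i = j then i \<in> W else i = c \<and> j \<in> B \<or> j = c \<and> i \<in> B)"

definition star_feasible :: "'a \<Rightarrow> 'a set \<Rightarrow> 'a set \<Rightarrow> 'a set \<Rightarrow> bool" where
  "star_feasible c W B X \<longleftrightarrow>
     (if c \<in> X then (\<exists>u\<in>B. X - {c} - W = {u}) \<or> X - {c} \<subseteq> W \<and> odd (card (X \<inter> B))
      else X \<subseteq> W)"

definition star_system :: "'a \<Rightarrow> 'a set \<Rightarrow> 'a set \<Rightarrow> 'a set \<Rightarrow> 'a set \<times> 'a set set" where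
  "star_system c W B E = (E, {X. X \<subseteq> E \<and> star_feasible c W B X})"

section \<open>Principal minors of star matrices over the field with two elements\<close>

lemma of_int_sign_bit: "of_int (sign p) = (1 :: bit)"
  by (auto simp: sign_def)

lemma of_nat_bit_nonzero_iff: "(of_nat n :: bit) \<noteq> 0 \<longleftrightarrow> odd n"
  by (induction n) auto

lemma prod_of_bool_eq:
  assumes "finite X"
  shows "(\<Prod>i\<in>X. of_bool (P i) :: 'b :: comm_semiring_1) = of_bool (\<forall>i\<in>X. P i)"
  using assms by induction auto

lemma principal_minor_bit:
  "principal_minor A X = (\<Sum>p | p permutes X. \<Prod>i\<in>X. A i (p i) :: bit)"
  unfolding principal_minor_def of_int_sign_bit mult_1 ..

text \<open>Every edge meets \<open>c\<close>, so without \<open>c\<close> the submatrix is diagonal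
  and only the identity contributes to the Leibniz sum.\<close>

lemma principal_minor_star_matrix_off_centre:
  assumes "finite X" "c \<notin> X"
  shows "principal_minor (star_matrix c W B) X = of_bool (X \<subseteq> W)"
proof -
  have "(\<Prod>i\<in>X. star_matrix c W B i (p i)) = 0" if p: "p permutes X" "p \<noteq> id" for p
  proof -
    obtain i where i: "p i \<noteq> i" using p(2) by fastforce
    then have "i \<in> X" using p(1) by (metis permutes_not_in)
    moreover have "p i \<noteq> c" using \<open>i \<in> X\<close> p(1) assms(2) by (metis permutes_in_image)
    ultimately show ?thesis
      using assms i by (intro prod_zero bexI[of _ i]) (auto simp: star_matrix_def)
  qed
  then have "principal_minor (star_matrix c W B) X
      = (\<Sum>p\<in>{id}. \<Prod>i\<in>X. star_matrix c W B i (p i))"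
    unfolding principal_minor_bit
    by (intro sum.mono_neutral_right) (auto simp: finite_permutations assms(1) permutes_id)
  also have "\<dots> = of_bool (X \<subseteq> W)"
    by (simp add: star_matrix_def prod_of_bool_eq assms(1) subset_eq del: of_bool_eq_iff)
  finally show ?thesis .
qed

text \<open>In a nonzero Leibniz term the unlooped \<open>c\<close> must go to a neighbour
  \<open>v\<close>. Injectivity forces \<open>v\<close> back to \<open>c\<close>, and every other
  vertex, adjacent at most to \<open>c\<close>, is fixed. So the permutation is the transposition of
  \<open>c\<close> and \<open>v\<close>, and its term is 1 exactly when all remaining vertices carry
  loops.\<close>

lemma principal_minor_star_matrix_centre:
  assumes "finite X" "c \<in> X" "c \<notin> W" "c \<notin> B"
  shows "principal_minor (star_matrix c W B) X = of_nat (card {v \<in> X \<inter> B. X - {c, v} \<subseteq> W})"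
proof -
  let ?A = "star_matrix c W B"
  have zero: "(\<Prod>i\<in>X. ?A i (p i)) = 0"
    if p: "p permutes X" and ne: "p \<notin> transpose c ` (X \<inter> B)" for p
  proof (rule ccontr)
    assume "(\<Prod>i\<in>X. ?A i (p i)) \<noteq> 0"
    then have nz: "?A i (p i) \<noteq> 0" if "i \<in> X" for i
      using assms(1) that by (meson prod_zero)
    define v where "v = p c"
    have v: "v \<in> B" "v \<noteq> c"
      using nz[OF assms(2)] assms(3,4) by (auto simp: star_matrix_def v_def split: if_splits)
    have vX: "v \<in> X" using p assms(2) unfolding v_def by (simp add: permutes_in_image)
    have inj: "inj p" using p by (rule permutes_inj)
    have pv: "p v = c"
    proof -
      have "p v \<noteq> v" using v inj unfolding v_def by (metis injD)
      then show ?thesis using nz[OF vX] v by (auto simp: star_matrix_def split: if_splits)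
    qed
    have "p i = transpose c v i" for i
    proof (cases "i \<in> X \<and> i \<noteq> c \<and> i \<noteq> v")
      case True
      then have "p i \<noteq> c" using pv inj by (metis injD)
      then show ?thesis using nz[of i] True by (auto simp: star_matrix_def split: if_splits)
    next
      case False
      then show ?thesis
        using pv v_def p vX assms(2) by (auto simp: transpose_def permutes_not_in)
    qed
    then show False using ne vX v by auto
  qed
  have inj: "inj_on (transpose c) (X \<inter> B)"
    by (rule inj_onI) (metis transpose_apply_first)
  have "principal_minor ?A X = (\<Sum>p\<in>transpose c ` (X \<inter> B). \<Prod>i\<in>X. ?A i (p i))"
    unfolding principal_minor_bit
    by (intro sum.mono_neutral_right)
      (auto simp: finite_permutations assms(1,2) permutes_swap_id zero)
  also have "\<dots> = (\<Sum>v\<in>X \<inter> B. \<Prod>i\<in>X. ?A i (transpose c v i))"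
    by (simp add: sum.reindex[OF inj])
  also have "\<dots> = (\<Sum>v\<in>X \<inter> B. of_bool (X - {c, v} \<subseteq> W))"
  proof (rule sum.cong[OF refl])
    fix v assume v: "v \<in> X \<inter> B"
    then have "v \<noteq> c" using assms(4) by auto
    then show "(\<Prod>i\<in>X. ?A i (transpose c v i)) = of_bool (X - {c, v} \<subseteq> W)"
      unfolding star_matrix_def prod_of_bool_eq[OF assms(1)] using v assms(2-4)
      by (intro arg_cong[where f = of_bool]) (auto simp: transpose_def)
  qed
  also have "\<dots> = of_nat (card {v \<in> X \<inter> B. X - {c, v} \<subseteq> W})"
    using assms(1) by (simp add: sum_of_bool_eq Int_def)
  finally show ?thesis .
qed

text \<open>The split is by the number of unlooped vertices of \<open>X\<close> other than
  \<open>c\<close>. With none, every \<open>v\<close> in \<open>X \<inter> B\<close> is counted and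
  parity decides; with exactly one, only that vertex can be \<open>v\<close>; with two or more, no
  transposition survives.\<close>

lemma principal_minor_star_matrix_nonzero_iff:
  assumes "finite X" "c \<notin> W" "c \<notin> B"
  shows "principal_minor (star_matrix c W B) X \<noteq> 0 \<longleftrightarrow> star_feasible c W B X"
proof (cases "c \<in> X")
  case False
  then show ?thesis
    by (simp add: principal_minor_star_matrix_off_centre[OF assms(1)] star_feasible_def)
next
  case True
  let ?S = "{v \<in> X \<inter> B. X - {c, v} \<subseteq> W}"
  have minor: "principal_minor (star_matrix c W B) X \<noteq> 0 \<longleftrightarrow> odd (card ?S)"
    unfolding principal_minor_star_matrix_centre[OF assms(1) True assms(2,3)]
    by (rule of_nat_bit_nonzero_iff)
  consider "X - {c} \<subseteq> W" | u where "X - {c} - W = {u}"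
    | u v where "u \<in> X - {c} - W" "v \<in> X - {c} - W" "u \<noteq> v"
    by blast
  then have "odd (card ?S) \<longleftrightarrow> star_feasible c W B X"
  proof cases
    case 1
    then have "?S = X \<inter> B" by blast
    then show ?thesis using 1 True by (auto simp: star_feasible_def)
  next
    case 2
    then have "?S = (if u \<in> B then {u} else {})" by auto
    moreover have "\<not> X - {c} \<subseteq> W" using 2 by blast
    ultimately show ?thesis using 2 True by (auto simp: star_feasible_def)
  next
    case 3
    then have "?S = {}" by blast
    then have "even (card ?S)" by (simp only: card.empty even_zero)
    have "\<not> X - {c} \<subseteq> W" using 3 by blast
    moreover have "X - {c} - W \<noteq> {w}" for w using 3 by (metis singletonD)
    ultimately have "\<not> star_feasible c W B X" using True by (simp add: star_feasible_def)
    then show ?thesis using \<open>even (card ?S)\<close> by blast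
  qed
  then show ?thesis using minor by simp
qed

section \<open>Restrictions of star systems and their dependence on the neighbour set\<close>

lemma fst_star_system [simp]: "fst (star_system c W B E) = E"
  by (simp add: star_system_def)

lemma binary_delta_matroid_star_system:
  assumes "finite E" "c \<notin> W" "c \<notin> B"
  shows "binary_delta_matroid (star_system c W B E)"
proof -
  have "star_system c W B E = twist (matrix_system E (star_matrix c W B)) {}"
    using assms principal_minor_star_matrix_nonzero_iff[OF _ assms(2,3)]
    by (auto simp: star_system_def twist_def matrix_system_def finite_subset)
  moreover have "star_matrix c W B i j = star_matrix c W B j i" for i j
    by (auto simp: star_matrix_def)
  ultimately show ?thesis
    unfolding binary_delta_matroid_def fst_star_system using assms(1)
    by (intro conjI exI[of _ "star_matrix c W B"] exI[of _ "{}"]) simp_all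
qed

lemma star_feasible_empty: "star_feasible c W B {}"
  by (simp add: star_feasible_def)

lemma set_system_star_system: "finite E \<Longrightarrow> set_system (star_system c W B E)"
  using star_feasible_empty[of c W B] by (auto simp: star_system_def set_system_def)

text \<open>Since \<open>{}\<close> is feasible, the coloop branch of \<open>restriction\<close> is
  never taken, and \<open>star_feasible\<close> does not refer to the ground set.\<close>

lemma restriction_star_system:
  assumes "E' \<subseteq> E"
  shows "restriction (star_system c W B E) E' = star_system c W B E'"
proof -
  have "\<exists>F\<in>snd (star_system c W B E). F \<subseteq> E'"
    by (rule bexI[of _ "{}"]) (auto simp: star_system_def star_feasible_empty)
  then show ?thesis using assms by (auto simp: restriction_def star_system_def)
qed

lemma star_system_cong:
  assumes "B \<inter> E = B' \<inter> E" shows "star_system c W B E = star_system c W B' E"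
proof -
  have "star_feasible c W B X = star_feasible c W B' X" if "X \<subseteq> E" for X
  proof -
    have "X \<inter> B = X \<inter> B'" using assms that by blast
    moreover have "(\<exists>u\<in>B. X - {c} - W = {u}) \<longleftrightarrow> (\<exists>u\<in>B'. X - {c} - W = {u})"
      using assms that by blast
    ultimately show ?thesis by (simp add: star_feasible_def)
  qed
  then show ?thesis by (auto simp: star_system_def)
qed

text \<open>The vertices of \<open>Y\<close> are isolated, so all they have to satisfy is to be
  looped, independently of \<open>X\<close>. This is the source of the product formula for
  stars.\<close>

lemma star_feasible_Un:
  assumes "c \<notin> Y" "B \<inter> Y = {}"
  shows "star_feasible c W B (X \<union> Y) \<longleftrightarrow> star_feasible c W B X \<and> star_feasible c W B Y"
proof (cases "c \<in> X")
  case True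
  have "(X \<union> Y) \<inter> B = X \<inter> B" using assms by blast
  moreover have "X \<union> Y - {c} - W = {u} \<longleftrightarrow> X - {c} - W = {u} \<and> Y \<subseteq> W" if "u \<in> B" for u
    using assms that by auto
  ultimately show ?thesis using True assms by (auto simp: star_feasible_def)
qed (use assms in \<open>auto simp: star_feasible_def\<close>)

lemma star_system_off_centre:
  assumes "c \<notin> E" shows "star_system c W B E = star_system c W B' E"
proof -
  have "star_feasible c W B X = star_feasible c W B' X" if "X \<subseteq> E" for X
    using assms that by (auto simp: star_feasible_def)
  then show ?thesis by (auto simp: star_system_def)
qed

section \<open>Signed sums over subsets and partitions\<close>

text \<open>Toggling \<open>v\<close> is a sign-reversing involution on the subsets of
  \<open>L\<close>. This one cancellation serves the partition identity, the mixed coproduct terms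
  and the leading coefficient.\<close>

lemma sum_Pow_sign_cancel:
  fixes h :: "'a set \<Rightarrow> 'b :: ab_group_add"
  assumes "finite L" "v \<in> L" and "\<And>B. B \<subseteq> L - {v} \<Longrightarrow> h (insert v B) = - h B"
  shows "(\<Sum>B\<in>Pow L. h B) = 0"
proof -
  have L: "L = insert v (L - {v})" using assms(2) by blast
  have inj: "inj_on (insert v) (Pow (L - {v}))"
    by (rule inj_onI) (metis Diff_insert_absorb PowD insert_absorb insert_ident subset_Diff_insert)
  have "(\<Sum>B\<in>Pow L. h B)
      = (\<Sum>B\<in>Pow (L - {v}). h B) + (\<Sum>B\<in>insert v ` Pow (L - {v}). h B)"
    by (subst L, subst Pow_insert, rule sum.union_disjoint) (use assms(1) in auto)
  also have "(\<Sum>B\<in>insert v ` Pow (L - {v}). h B) = (\<Sum>B\<in>Pow (L - {v}). - h B)"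
    by (subst sum.reindex[OF inj]) (auto intro!: sum.cong simp: assms(3))
  finally show ?thesis by (simp add: sum_negf)
qed

lemma card_Diff_insert_sign:
  assumes "finite L" "v \<in> L" "B \<subseteq> L - {v}"
  shows "(-1) ^ card (L - insert v B) = - ((-1) ^ card (L - B) :: 'b :: comm_ring_1)"
proof -
  have "L - B = insert v (L - insert v B)" using assms(2,3) by blast
  then have "card (L - B) = Suc (card (L - insert v B))"
    using assms(1) by (metis Diff_iff card_insert_disjoint finite_Diff insertI1)
  then show ?thesis by simp
qed

text \<open>Removing a marked block is a bijection from partitions with a marked block to pairs of a
  nonempty \<open>C\<close> and a partition of \<open>A - C\<close>.\<close>

lemma sum_partition_block:
  fixes h :: "'a set set \<Rightarrow> 'a set \<Rightarrow> 'b :: comm_monoid_add"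
  assumes "finite A"
  shows "(\<Sum>P | partition_on A P. \<Sum>C\<in>P. h P C)
       = (\<Sum>C\<in>Pow A - {{}}. \<Sum>Q | partition_on (A - C) Q. h (insert C Q) C)"
proof -
  have fin: "finite {P. partition_on A' P}" if "A' \<subseteq> A" for A'
    using finitely_many_partition_on finite_subset[OF that assms] by blast
  have "(\<Sum>P | partition_on A P. \<Sum>C\<in>P. h P C)
      = (\<Sum>(P, C)\<in>Sigma {P. partition_on A P} (\<lambda>P. P). h P C)"
    by (rule sum.Sigma) (use fin finite_elements[OF assms] in auto)
  also have "\<dots> = (\<Sum>(C, Q)\<in>Sigma (Pow A - {{}}) (\<lambda>C. {Q. partition_on (A - C) Q}).
      h (insert C Q) C)"
  proof (rule sum.reindex_bij_witness[where j = "\<lambda>(P, C). (C, P - {C})"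
        and i = "\<lambda>(C, Q). (insert C Q, C)"], goal_cases)
    case (2 x)
    obtain P C where x: "x = (P, C)" "partition_on A P" "C \<in> P" using 2 by auto
    have "disjnt C (\<Union> (P - {C}))"
      using x partition_onD2[OF x(2)] by (auto simp: disjnt_iff disjoint_def)
    then show ?case
      using x partition_on_insert[of C "P - {C}" A] by (auto simp: insert_absorb)
  next
    case (4 y)
    obtain C Q where y: "y = (C, Q)" "C \<subseteq> A" "C \<noteq> {}" "partition_on (A - C) Q" using 4 by auto
    have "disjnt C (\<Union> Q)" using partition_onD1[OF y(4)] by (auto simp: disjnt_iff)
    then show ?case using y partition_on_insert[of C Q A] by auto
  next
    case (3 y)
    obtain C Q where y: "y = (C, Q)" "C \<subseteq> A" "C \<noteq> {}" "partition_on (A - C) Q" using 3 by auto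
    \<comment> \<open>Nonemptiness of \<open>C\<close> is what allows \<open>Q\<close> to be
      recovered from \<open>insert C Q\<close> by deleting \<open>C\<close>.\<close>
    have "C \<notin> Q" using partition_onD1[OF y(4)] y(3) by blast
    then show ?case using y by auto
  qed (auto simp: insert_absorb)
  also have "\<dots> = (\<Sum>C\<in>Pow A - {{}}. \<Sum>Q | partition_on (A - C) Q. h (insert C Q) C)"
    by (rule sum.Sigma[symmetric]) (use fin assms in auto)
  finally show ?thesis .
qed

text \<open>Exactly one block contains \<open>c\<close>, so summing over marked blocks with the
  indicator of \<open>c \<in> C\<close> counts each partition once.\<close>

lemma sum_partition_containing:
  fixes g :: "'a set set \<Rightarrow> 'b :: comm_monoid_add"
  assumes "finite A" "c \<in> A"
  shows "(\<Sum>P | partition_on A P. g P)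
       = (\<Sum>C | C \<subseteq> A \<and> c \<in> C. \<Sum>Q | partition_on (A - C) Q. g (insert C Q))"
proof -
  have "(\<Sum>P | partition_on A P. g P)
      = (\<Sum>P | partition_on A P. \<Sum>C\<in>P. if c \<in> C then g P else 0)"
  proof (rule sum.cong[OF refl])
    fix P assume "P \<in> {P. partition_on A P}"
    then have P: "partition_on A P" by simp
    obtain C where C: "C \<in> P" "c \<in> C" using partition_onD1[OF P] assms(2) by blast
    have "{C' \<in> P. c \<in> C'} = {C}"
      using C partition_onD2[OF P] by (auto simp: disjoint_def)
    then show "g P = (\<Sum>C\<in>P. if c \<in> C then g P else 0)"
      using finite_elements[OF assms(1) P] by (simp add: sum.If_cases Int_def)
  qed
  also have "\<dots> = (\<Sum>C\<in>Pow A - {{}}. \<Sum>Q | partition_on (A - C) Q.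
      if c \<in> C then g (insert C Q) else 0)"
    by (rule sum_partition_block[OF assms(1)])
  also have "\<dots> = (\<Sum>C | C \<subseteq> A \<and> c \<in> C. \<Sum>Q | partition_on (A - C) Q. g (insert C Q))"
    by (rule sum.mono_neutral_cong_right) (use assms in auto)
  finally show ?thesis .
qed

text \<open>Writing k! as k times (k-1)! marks one of the k blocks; removing it leaves the same sum
  on a smaller set with opposite sign, which suits strong induction. In exponential generating
  functions this is 1/(1 + (e^x - 1)) = e^(-x).\<close>

lemma sum_partition_sign_fact:
  assumes "finite A"
  shows "(\<Sum>Q | partition_on A Q. (-1) ^ card Q * of_nat (fact (card Q)))
       = ((-1) ^ card A :: 'b :: comm_ring_1)"
  using assms
proof (induction A rule: finite_psubset_induct)
  case (psubset A)
  let ?w = "\<lambda>Q :: 'a set set. (-1) ^ card Q * of_nat (fact (card Q)) :: 'b"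
  show ?case
  proof (cases "A = {}")
    case True
    then show ?thesis by (simp add: partition_on_empty)
  next
    case False
    then obtain a where a: "a \<in> A" by blast
    have "(\<Sum>Q | partition_on A Q. ?w Q)
        = (\<Sum>P | partition_on A P. \<Sum>C\<in>P. (-1) ^ card P * of_nat (fact (card P - 1)))"
    proof (rule sum.cong[OF refl])
      fix P assume "P \<in> {P. partition_on A P}"
      then have "finite P" "P \<noteq> {}"
        using finite_elements[OF psubset(1)] False by (auto simp: partition_on_def)
      then have "fact (card P) = card P * (fact (card P - 1) :: nat)"
        by (metis card_gt_0_iff fact_reduce of_nat_id)
      then show "?w P = (\<Sum>C\<in>P. (-1) ^ card P * of_nat (fact (card P - 1)))"
        by (simp only: sum_constant of_nat_mult mult.left_commute)
    qed
    also have "\<dots> = (\<Sum>C\<in>Pow A - {{}}. \<Sum>Q | partition_on (A - C) Q.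
        (-1) ^ card (insert C Q) * of_nat (fact (card (insert C Q) - 1)))"
      by (rule sum_partition_block[OF psubset(1)])
    also have "\<dots> = (\<Sum>C\<in>Pow A - {{}}. - ((-1) ^ card (A - C)))"
    proof (rule sum.cong[OF refl])
      fix C assume C: "C \<in> Pow A - {{}}"
      have "(\<Sum>Q | partition_on (A - C) Q.
          (-1) ^ card (insert C Q) * of_nat (fact (card (insert C Q) - 1)))
        = (\<Sum>Q | partition_on (A - C) Q. - ?w Q)"
      proof (rule sum.cong[OF refl])
        fix Q assume "Q \<in> {Q. partition_on (A - C) Q}"
        then have Q: "partition_on (A - C) Q" by simp
        have "C \<notin> Q" using partition_onD1[OF Q] C by blast
        moreover have "finite Q" using finite_elements[OF _ Q] psubset(1) by simp
        ultimately show "(-1) ^ card (insert C Q) * of_nat (fact (card (insert C Q) - 1)) = - ?w Q"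
          by simp
      qed
      also have "\<dots> = - ((-1) ^ card (A - C))"
        using psubset.IH[of "A - C"] C by (subst sum_negf) auto
      finally show "(\<Sum>Q | partition_on (A - C) Q.
          (-1) ^ card (insert C Q) * of_nat (fact (card (insert C Q) - 1)))
        = (- ((-1) ^ card (A - C)) :: 'b)" .
    qed
    \<comment> \<open>Adding the missing term \<open>C = {}\<close> completes the sum to all of
      \<open>Pow A\<close>, where it cancels; the compensation \<open>(-1) ^ card A\<close> is the
      result.\<close>
    also have "\<dots> = (-1) ^ card A - (\<Sum>C\<in>Pow A. (-1) ^ card (A - C))"
      using psubset(1) by (simp add: sum_negf sum_diff1)
    also have "(\<Sum>C\<in>Pow A. (-1) ^ card (A - C)) = (0 :: 'b)"
      by (rule sum_Pow_sign_cancel[OF psubset(1) a]) (rule card_Diff_insert_sign[OF psubset(1) a])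
    finally show ?thesis by simp
  qed
qed

section \<open>Linear extensions\<close>

text \<open>\<open>coproduct\<close>, \<open>interlace\<close> and \<open>primitive\<close> are
  defined by sums over keys. Stars for different \<open>B\<close> can be isomorphic, so
  \<open>f\<close> is not assumed injective; additivity of \<open>h c\<close> absorbs collisions,
  and \<open>h c 0 = 0\<close> covers coefficients that cancel.\<close>

lemma sum_keys_additive:
  fixes h :: "'a \<Rightarrow> 'b :: comm_monoid_add \<Rightarrow> 'c :: comm_monoid_add"
  assumes "finite I" "\<And>c. h c 0 = 0" "\<And>c a b. h c (a + b) = h c a + h c b"
  shows "(\<Sum>c\<in>Poly_Mapping.keys (\<Sum>i\<in>I. Poly_Mapping.single (f i) (a i)).
            h c (Poly_Mapping.lookup (\<Sum>i\<in>I. Poly_Mapping.single (f i) (a i)) c))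
       = (\<Sum>i\<in>I. h (f i) (a i))"
proof -
  let ?p = "\<Sum>i\<in>I. Poly_Mapping.single (f i) (a i)"
  have lookup: "Poly_Mapping.lookup ?p c = (\<Sum>i\<in>I. if f i = c then a i else 0)" for c
    by (simp add: lookup_sum lookup_single when_def)
  have h_sum: "h c (\<Sum>i\<in>J. g i) = (\<Sum>i\<in>J. h c (g i))" for c and g :: "_ \<Rightarrow> 'b" and J :: "_ set"
    by (induction J rule: infinite_finite_induct) (auto simp: assms)
  have keys: "Poly_Mapping.keys ?p \<subseteq> f ` I"
    by (auto simp: in_keys_iff lookup elim!: sum.not_neutral_contains_not_neutral split: if_splits)
  have "(\<Sum>c\<in>Poly_Mapping.keys ?p. h c (Poly_Mapping.lookup ?p c))
      = (\<Sum>c\<in>f ` I. h c (Poly_Mapping.lookup ?p c))"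
    by (rule sum.mono_neutral_left) (use keys assms in \<open>auto simp: in_keys_iff\<close>)
  also have "\<dots> = (\<Sum>c\<in>f ` I. \<Sum>i\<in>I. if f i = c then h (f i) (a i) else 0)"
    unfolding lookup h_sum by (intro sum.cong refl) (auto simp: assms(2))
  also have "\<dots> = (\<Sum>i\<in>I. \<Sum>c\<in>f ` I. if f i = c then h (f i) (a i) else 0)"
    by (rule sum.swap)
  also have "\<dots> = (\<Sum>i\<in>I. h (f i) (a i))"
    using assms(1) by (intro sum.cong refl) (simp add: sum.delta')
  finally show ?thesis .
qed

lemma map_times_add:
  fixes a :: "'b :: ring"
  shows "Poly_Mapping.map (\<lambda>x. (a + b) * x) p
       = Poly_Mapping.map (\<lambda>x. a * x) p + Poly_Mapping.map (\<lambda>x. b * x) p"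
  by (rule poly_mapping_eqI) (simp add: Poly_Mapping.map.rep_eq lookup_add when_def distrib_right)

lemma map_times_sum_single:
  fixes a :: "'b :: ring"
  shows "Poly_Mapping.map (\<lambda>x. a * x) (\<Sum>i\<in>I. Poly_Mapping.single (f i) (b i))
       = (\<Sum>i\<in>I. Poly_Mapping.single (f i) (a * b i))"
proof (rule poly_mapping_eqI)
  fix k
  have "Poly_Mapping.lookup (\<Sum>i\<in>I. Poly_Mapping.single (f i) (a * b i)) k
      = a * Poly_Mapping.lookup (\<Sum>i\<in>I. Poly_Mapping.single (f i) (b i)) k"
    unfolding lookup_sum lookup_single when_def sum_distrib_left by (intro sum.cong) auto
  then show "Poly_Mapping.lookup (Poly_Mapping.map (\<lambda>x. a * x)
        (\<Sum>i\<in>I. Poly_Mapping.single (f i) (b i))) k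
      = Poly_Mapping.lookup (\<Sum>i\<in>I. Poly_Mapping.single (f i) (a * b i)) k"
    by (simp add: Poly_Mapping.map.rep_eq when_def)
qed

lemma map_times_zero:
  "Poly_Mapping.map (\<lambda>x. 0 * x) p = (0 :: 'a \<Rightarrow>\<^sub>0 'b :: ring)"
  by (rule poly_mapping_eqI) (simp add: Poly_Mapping.map.rep_eq when_def)

lemma class_interlace_poly_abs:
  "set_system D \<Longrightarrow> class_interlace_poly (abs_ss_class D) = interlace_poly D"
  by (simp add: class_interlace_poly.abs_eq ss_iso_refl)

lemma class_coproduct_abs:
  "set_system D \<Longrightarrow> class_coproduct (abs_ss_class D) = ss_coproduct D"
  by (simp add: class_coproduct.abs_eq ss_iso_refl)

lemma interlace_sum_single:
  assumes "finite I" "\<And>i. i \<in> I \<Longrightarrow> set_system (D i)"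
  shows "interlace (\<Sum>i\<in>I. Poly_Mapping.single (abs_ss_class (D i)) (a i))
       = (\<Sum>i\<in>I. smult (a i) (interlace_poly (D i)))"
  unfolding interlace_def using assms
  by (subst sum_keys_additive) (auto simp: smult_add_left class_interlace_poly_abs intro!: sum.cong)

lemma coproduct_sum_single:
  assumes "finite I" "\<And>i. i \<in> I \<Longrightarrow> set_system (D i)"
  shows "coproduct (\<Sum>i\<in>I. Poly_Mapping.single (abs_ss_class (D i)) (a i))
       = (\<Sum>i\<in>I. Poly_Mapping.map (\<lambda>x. a i * x) (ss_coproduct (D i)))"
  unfolding coproduct_def using assms
  by (subst sum_keys_additive)
    (auto simp: map_times_add map_times_zero class_coproduct_abs intro!: sum.cong)

lemma primitive_sum_single_iff:
  assumes "finite I"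
  shows "primitive (\<Sum>i\<in>I. Poly_Mapping.single (f i) (a i)) \<longleftrightarrow>
     coproduct (\<Sum>i\<in>I. Poly_Mapping.single (f i) (a i)) =
       (\<Sum>i\<in>I. Poly_Mapping.single (0, f i) (a i)) + (\<Sum>i\<in>I. Poly_Mapping.single (f i, 0) (a i))"
  unfolding primitive_def
  by (subst sum_keys_additive[OF assms], (simp_all add: single_add)[2])+ simp

text \<open>\<open>disjoint_sum\<close> tags the elements of its two arguments. For disjoint ground
  sets, forgetting the tags is injective, so the product is the class of the untagged union.\<close>

lemma ss_gen_mult:
  assumes "set_system D1" "set_system D2" "fst D1 \<inter> fst D2 = {}"
  shows "ss_gen D1 * ss_gen D2
       = ss_gen (fst D1 \<union> fst D2, {F1 \<union> F2 | F1 F2. F1 \<in> snd D1 \<and> F2 \<in> snd D2})"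
    (is "_ = ss_gen ?D")
proof -
  define h where "h = (\<lambda>z. case sum_decode z of Inl a \<Rightarrow> a | Inr b \<Rightarrow> b)"
  have h: "h ` sum_encode ` (A <+> B) = A \<union> B" for A B
    by (simp add: h_def image_image Plus_def image_Un)
  have "inj_on h (sum_encode ` (fst D1 <+> fst D2))"
    using assms(3) by (auto simp: h_def inj_on_def sum_encode_eq)
  then have "bij_betw h (fst (disjoint_sum D1 D2)) (fst ?D)"
    by (simp add: bij_betw_def disjoint_sum_def h)
  moreover have "snd ?D = (\<lambda>F. h ` F) ` snd (disjoint_sum D1 D2)"
  proof -
    have "snd ?D = {h ` sum_encode ` (F1 <+> F2) | F1 F2. F1 \<in> snd D1 \<and> F2 \<in> snd D2}"
      by (simp add: h)
    also have "\<dots> = (\<lambda>F. h ` F) ` snd (disjoint_sum D1 D2)"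
      unfolding disjoint_sum_def by (simp only: fst_conv snd_conv) blast
    finally show ?thesis .
  qed
  ultimately have "ss_iso (disjoint_sum D1 D2) ?D" unfolding ss_iso_def by blast
  moreover have "set_system ?D"
    using assms unfolding set_system_def by fastforce
  ultimately have "abs_ss_class (disjoint_sum D1 D2) = abs_ss_class ?D"
    using set_system_disjoint_sum[OF assms(1,2)]
    by (simp add: Quotient3_rel_abs[OF Quotient3_ss_class])
  moreover have "abs_ss_class D1 + abs_ss_class D2 = abs_ss_class (disjoint_sum D1 D2)"
    using assms by (simp add: plus_ss_class.abs_eq ss_iso_refl)
  ultimately show ?thesis by (simp add: ss_gen_def mult_single)
qed

section \<open>The primitive element of a star\<close>

lemma abs_ss_class_star_system_empty: "abs_ss_class (star_system c W B {}) = 0"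
  using star_feasible_empty[of c W B]
  by (simp add: star_system_def zero_ss_class.abs_eq conj_commute cong: conj_cong)

text \<open>All vertices of \<open>E2\<close> are isolated, so multiplying by its system only
  enlarges the ground set of the star. \<open>B'\<close> is arbitrary because \<open>E2\<close>
  avoids the centre.\<close>

lemma ss_gen_star_system_mult:
  assumes "finite E1" "finite E2" "E1 \<inter> E2 = {}" "c \<notin> E2" "B \<inter> E2 = {}"
  shows "ss_gen (star_system c W B E1) * ss_gen (star_system c W B' E2)
       = ss_gen (star_system c W B (E1 \<union> E2))"
proof -
  have "{F1 \<union> F2 | F1 F2. F1 \<in> snd (star_system c W B E1) \<and> F2 \<in> snd (star_system c W B E2)}
      = {X. X \<subseteq> E1 \<union> E2 \<and> star_feasible c W B X}" (is "?L = ?R")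
  proof
    have "star_feasible c W B (F1 \<union> F2) \<longleftrightarrow> star_feasible c W B F1 \<and> star_feasible c W B F2"
      if "F2 \<subseteq> E2" for F1 F2
      by (rule star_feasible_Un) (use that assms in auto)
    note Un = this
    show "?L \<subseteq> ?R" by (auto simp: star_system_def Un)
    show "?R \<subseteq> ?L"
    proof
      fix X assume X: "X \<in> ?R"
      then have split: "X = (X \<inter> E1) \<union> (X \<inter> E2)" by blast
      then have "star_feasible c W B (X \<inter> E1) \<and> star_feasible c W B (X \<inter> E2)"
        using X Un[of "X \<inter> E2" "X \<inter> E1"] by simp
      then have "X \<inter> E1 \<in> snd (star_system c W B E1)" "X \<inter> E2 \<in> snd (star_system c W B E2)"
        by (simp_all add: star_system_def)
      then show "X \<in> ?L" using split by blast
    qed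
  qed
  then show ?thesis
    using ss_gen_mult[of "star_system c W B E1" "star_system c W B E2"] assms
      star_system_off_centre[OF assms(4), of W B' B]
    by (simp add: set_system_star_system star_system_def[of c W B "E1 \<union> E2"])
qed

text \<open>Blocks avoiding the centre carry no edges. Replacing \<open>B\<close> by
  \<open>{}\<close> first makes the two-factor product formula applicable in each induction
  step.\<close>

lemma prod_ss_gen_star_system:
  assumes "finite Q" "disjoint Q" "\<And>C. C \<in> Q \<Longrightarrow> finite C \<and> c \<notin> C"
  shows "(\<Prod>C\<in>Q. ss_gen (star_system c W B C)) = ss_gen (star_system c W {} (\<Union>Q))"
  using assms
proof (induction Q rule: finite_induct)
  case empty
  then show ?case by (simp add: ss_gen_def abs_ss_class_star_system_empty)
next
  case (insert C Q)
  have "(\<Prod>C\<in>insert C Q. ss_gen (star_system c W B C))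
      = ss_gen (star_system c W B C) * ss_gen (star_system c W {} (\<Union>Q))"
    using insert by (simp add: pairwise_insert)
  also have "star_system c W B C = star_system c W {} C"
    using insert by (intro star_system_off_centre) auto
  also have "ss_gen (star_system c W {} C) * ss_gen (star_system c W {} (\<Union>Q))
      = ss_gen (star_system c W {} (C \<union> \<Union>Q))"
  proof (rule ss_gen_star_system_mult)
    show "C \<inter> \<Union>Q = {}"
      using insert.hyps insert.prems(1) by (auto simp: pairwise_insert disjnt_iff)
  qed (use insert in auto)
  finally show ?case by simp
qed

text \<open>A partition-free form of the projection, from which grading, primitivity and degree are
  derived.\<close>

definition star_primitive :: "nat \<Rightarrow> nat set \<Rightarrow> nat set \<Rightarrow> ss_class \<Rightarrow>\<^sub>0 complex" where
  "star_primitive c W E = (\<Sum>B\<in>Pow (E - {c}).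
     Poly_Mapping.single (abs_ss_class (star_system c W B E)) ((-1) ^ card (E - {c} - B)))"

lemma prim_proj_star_system:
  assumes "finite E" "c \<in> E"
  shows "prim_proj (star_system c W (E - {c}) E) = star_primitive c W E"
proof -
  let ?g = "\<lambda>C. ss_gen (star_system c W (E - {c}) C)"
  let ?w = "\<lambda>k :: nat. (-1) ^ k * of_nat (fact k) :: ss_class \<Rightarrow>\<^sub>0 complex"
  have part: "finite {P. partition_on A P}" if "A \<subseteq> E" for A
    using finitely_many_partition_on finite_subset[OF that assms(1)] by blast
  \<comment> \<open>Ensures that the range of \<open>k\<close> in \<open>prim_proj\<close> misses no
    partition, so that the sum over \<open>k\<close> merges into one sum over all
    partitions.\<close>
  have card: "card P \<in> {1..card E}" if P: "partition_on E P" for P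
  proof -
    have "P \<noteq> {}" using P assms(2) by (auto simp: partition_on_def)
    moreover have "finite P" using finite_elements[OF assms(1) P] .
    moreover have "card P \<le> card E"
    proof -
      have "card P = (\<Sum>C\<in>P. 1)" by simp
      also have "\<dots> \<le> (\<Sum>C\<in>P. card C)"
        using P assms(1) by (intro sum_mono) (auto simp: partition_on_def Suc_le_eq card_gt_0_iff
            intro: finite_subset)
      also have "\<dots> = card E"
        using card_Union_disjoint[OF partition_onD2[OF P]] partition_onD1[OF P] assms(1)
        by (metis Union_upper finite_subset)
      finally show ?thesis .
    qed
    ultimately show ?thesis by (simp add: Suc_le_eq card_gt_0_iff)
  qed
  have "prim_proj (star_system c W (E - {c}) E)
      = (\<Sum>k = 1..card E. \<Sum>P | partition_on E P \<and> card P = k. ?w (card P - 1) * (\<Prod>C\<in>P. ?g C))"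
    unfolding prim_proj_def fst_star_system sum_distrib_left
    by (intro sum.cong refl arg_cong2[where f = "(*)"] prod.cong)
      (auto intro!: arg_cong[where f = ss_gen] restriction_star_system simp: partition_on_def)
  also have "\<dots> = (\<Sum>P | partition_on E P. ?w (card P - 1) * (\<Prod>C\<in>P. ?g C))"
    using sum.group[OF part[OF order_refl] finite_atLeastAtMost[of 1 "card E"] image_subsetI,
        of card "\<lambda>P. ?w (card P - 1) * (\<Prod>C\<in>P. ?g C)"] card
    by (simp only: mem_Collect_eq)
  also have "\<dots> = (\<Sum>C | C \<subseteq> E \<and> c \<in> C. \<Sum>Q | partition_on (E - C) Q.
      ?w (card (insert C Q) - 1) * (\<Prod>C\<in>insert C Q. ?g C))"
    by (rule sum_partition_containing[OF assms])
  \<comment> \<open>With \<open>C\<close> the block of the centre, the other blocks multiply to the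
    edgeless system on \<open>E - C\<close>, whose vertices join the star on \<open>C\<close> as
    isolated ones. The weight index \<open>k - 1\<close> is \<open>card Q\<close>, so
    \<open>sum_partition_sign_fact\<close> on \<open>E - C\<close> gives the coefficient.\<close>
  also have "\<dots> = (\<Sum>C | C \<subseteq> E \<and> c \<in> C.
      (-1) ^ card (E - C) * ss_gen (star_system c W (C - {c}) E))"
  proof (rule sum.cong[OF refl])
    fix C assume "C \<in> {C. C \<subseteq> E \<and> c \<in> C}"
    then have C: "C \<subseteq> E" "c \<in> C" by auto
    have "(\<Sum>Q | partition_on (E - C) Q. ?w (card (insert C Q) - 1) * (\<Prod>C\<in>insert C Q. ?g C))
        = (\<Sum>Q | partition_on (E - C) Q. ?w (card Q) * ss_gen (star_system c W (C - {c}) E))"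
    proof (rule sum.cong[OF refl])
      fix Q assume "Q \<in> {Q. partition_on (E - C) Q}"
      then have Q: "partition_on (E - C) Q" by simp
      have Un: "\<Union>Q = E - C" using partition_onD1[OF Q] by simp
      have "C \<notin> Q" using Un C by blast
      moreover have fin: "finite Q" using finite_elements[OF _ Q] assms(1) by simp
      moreover have "(\<Prod>C\<in>Q. ?g C) = ss_gen (star_system c W {} (\<Union>Q))"
        using Un C finite_subset[OF _ assms(1)]
        by (intro prod_ss_gen_star_system fin partition_onD2[OF Q]) blast+
      moreover have "star_system c W (E - {c}) C = star_system c W (C - {c}) C"
        by (rule star_system_cong) (use C in auto)
      moreover have "ss_gen (star_system c W (C - {c}) C) * ss_gen (star_system c W {} (E - C))
          = ss_gen (star_system c W (C - {c}) (C \<union> (E - C)))"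
        by (rule ss_gen_star_system_mult) (use C assms finite_subset in auto)
      moreover have "C \<union> (E - C) = E" using C by blast
      ultimately show "?w (card (insert C Q) - 1) * (\<Prod>C\<in>insert C Q. ?g C)
          = ?w (card Q) * ss_gen (star_system c W (C - {c}) E)"
        by (simp add: Un)
    qed
    also have "\<dots> = (-1) ^ card (E - C) * ss_gen (star_system c W (C - {c}) E)"
      unfolding sum_distrib_right[symmetric] using assms(1)
      by (subst sum_partition_sign_fact) auto
    finally show "(\<Sum>Q | partition_on (E - C) Q.
          ?w (card (insert C Q) - 1) * (\<Prod>C\<in>insert C Q. ?g C))
        = (-1) ^ card (E - C) * ss_gen (star_system c W (C - {c}) E)" .
  qed
  also have "\<dots> = (\<Sum>B\<in>Pow (E - {c}).
      (-1) ^ card (E - {c} - B) * ss_gen (star_system c W B E))"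
    by (rule sum.reindex_bij_witness[where i = "insert c" and j = "\<lambda>C. C - {c}"])
      (use assms in \<open>auto intro!: arg_cong[where f = card] arg_cong2[where f = "(*)"]
        arg_cong2[where f = "(^)"] simp: insert_absorb\<close>)
  also have "\<dots> = star_primitive c W E"
  proof -
    \<comment> \<open>The sign, so far a factor in the monoid algebra, is moved into the
      coefficient.\<close>
    have "(-1) ^ k * Poly_Mapping.single x 1
        = (Poly_Mapping.single x ((-1) ^ k) :: ss_class \<Rightarrow>\<^sub>0 complex)"
      for k and x :: ss_class
      by (cases "even k") (auto simp: single_uminus)
    then show ?thesis unfolding star_primitive_def ss_gen_def by simp
  qed
  finally show ?thesis .
qed

lemma star_primitive_graded:
  assumes "finite E" "c \<notin> W"
  shows "star_primitive c W E \<in> graded_part (card E)"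
proof -
  have keys: "Poly_Mapping.keys (star_primitive c W E)
      \<subseteq> (\<lambda>B. abs_ss_class (star_system c W B E)) ` Pow (E - {c})"
    unfolding star_primitive_def by (rule order_trans[OF keys_sum]) auto
  have bin: "binary_delta_matroid (star_system c W B E)" if "B \<in> Pow (E - {c})" for B
    by (rule binary_delta_matroid_star_system[OF assms]) (use that in blast)
  have "\<exists>D. binary_delta_matroid D \<and> card (fst D) = card E \<and> x = abs_ss_class D"
    if x: "x \<in> Poly_Mapping.keys (star_primitive c W E)" for x
  proof -
    obtain B where "x = abs_ss_class (star_system c W B E)" "B \<in> Pow (E - {c})"
      using subsetD[OF keys x] by (rule imageE)
    then show ?thesis
      using bin by (intro exI[of _ "star_system c W B E"]) simp
  qed
  then show ?thesis by (simp add: graded_part_def)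
qed

lemma primitive_star_primitive:
  assumes "finite E" "c \<in> E"
  shows "primitive (star_primitive c W E)"
proof -
  let ?L = "E - {c}"
  let ?e = "\<lambda>B. (-1) ^ card (?L - B) :: complex"
  let ?cls = "\<lambda>B E'. abs_ss_class (star_system c W B E')"
  let ?T = "\<lambda>E' B. Poly_Mapping.single (?cls B E', ?cls B (E - E')) (?e B)"
  have fin: "finite (Pow ?L)" using assms(1) by simp
  have single: "Poly_Mapping.map (\<lambda>x. ?e B * x) (ss_coproduct (star_system c W B E))
      = (\<Sum>E'\<in>Pow E. ?T E' B)" for B
    unfolding ss_coproduct_def fst_star_system
    by (subst map_times_sum_single)
      (use assms(1) in \<open>auto intro!: sum.cong simp: restriction_star_system\<close>)
  have zero: "(\<Sum>B\<in>Pow ?L. ?T E' B) = 0" if E': "E' \<subseteq> E" "E' \<noteq> {}" "E' \<noteq> E" for E'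
  proof -
    \<comment> \<open>A leaf separated from \<open>c\<close> by \<open>E'\<close>: outside
      \<open>E'\<close> if \<open>c\<close> lies inside, and inside otherwise. Neither restriction
      then sees the edge between \<open>c\<close> and \<open>v\<close>, so toggling \<open>v\<close>
      in \<open>B\<close> changes only the sign.\<close>
    obtain v where v: "v \<in> E" "v \<noteq> c" "v \<in> E' \<longleftrightarrow> c \<notin> E'"
      using E' by (cases "c \<in> E'") auto
    have "?T E' (insert v B) = - ?T E' B" if B: "B \<subseteq> ?L - {v}" for B
    proof -
      have "star_system c W (insert v B) A = star_system c W B A" if "A = E' \<or> A = E - E'" for A
        using that v by (cases "v \<in> A") (auto intro: star_system_off_centre star_system_cong)
      then show ?thesis
        using card_Diff_insert_sign[where 'b = complex, of ?L v B] assms(1) v B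
        by (simp add: single_uminus)
    qed
    then show ?thesis by (intro sum_Pow_sign_cancel[of _ v]) (use assms(1) v in auto)
  qed
  have "coproduct (star_primitive c W E) = (\<Sum>B\<in>Pow ?L. \<Sum>E'\<in>Pow E. ?T E' B)"
    unfolding star_primitive_def
    by (subst coproduct_sum_single[OF fin]) (auto simp: set_system_star_system assms(1) single)
  also have "\<dots> = (\<Sum>E'\<in>Pow E. \<Sum>B\<in>Pow ?L. ?T E' B)"
    by (rule sum.swap)
  \<comment> \<open>The two remaining choices of \<open>E'\<close> give the terms
    \<open>1 \<otimes> p\<close> and \<open>p \<otimes> 1\<close>.\<close>
  also have "\<dots> = (\<Sum>E'\<in>{{}, E}. \<Sum>B\<in>Pow ?L. ?T E' B)"
    by (rule sum.mono_neutral_right) (use assms(1) zero in auto)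
  also have "\<dots> = (\<Sum>B\<in>Pow ?L. Poly_Mapping.single (0, ?cls B E) (?e B))
                + (\<Sum>B\<in>Pow ?L. Poly_Mapping.single (?cls B E, 0) (?e B))"
    using assms(2) by (subst sum.insert) (auto simp: abs_ss_class_star_system_empty)
  finally show ?thesis
    unfolding star_primitive_def by (subst primitive_sum_single_iff[OF fin])
qed

section \<open>Degree of the interlace polynomial\<close>

lemma distance_le:
  assumes "finite (snd D)" "F \<in> snd D" "card (sym_diff F X) \<le> k"
  shows "distance D X \<le> k"
  unfolding distance_def using assms by (meson Min_le dual_order.trans finite_imageI imageI)

lemma distance_ge:
  assumes "finite (snd D)" "snd D \<noteq> {}" "\<And>F. F \<in> snd D \<Longrightarrow> k \<le> card (sym_diff F X)"
  shows "k \<le> distance D X"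
  unfolding distance_def using assms by (subst Min_ge_iff) auto

context
  fixes c :: 'a and W B E U X :: "'a set" and D
  assumes fin: "finite E" and c: "c \<in> E" "c \<notin> W" and B: "B \<subseteq> E - {c}" and X: "X \<subseteq> E"
  defines "U \<equiv> E - {c} - W" and "D \<equiv> star_system c W B E"
begin

lemma finite_snd_star_system: "finite (snd D)"
  unfolding D_def star_system_def using fin by simp

lemma star_side_conditions: "finite U" "finite X" "c \<notin> U"
  using fin X by (auto simp: U_def finite_subset)

lemma distance_star_le: "distance D X \<le> card (X \<inter> U) + of_bool (c \<in> X)"
proof (rule distance_le[OF finite_snd_star_system])
  \<comment> \<open>The looped part of \<open>X\<close> avoids the centre and hence is feasible;
    passing to it deletes only \<open>X \<inter> U\<close> and possibly \<open>c\<close>.\<close>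
  show "X \<inter> W \<in> snd D" using X c by (auto simp: D_def star_system_def star_feasible_def)
  have "sym_diff (X \<inter> W) X = (X \<inter> U) \<union> (X \<inter> {c})" using X c by (auto simp: U_def)
  then show "card (sym_diff (X \<inter> W) X) \<le> card (X \<inter> U) + of_bool (c \<in> X)"
    using card_Un_le[of "X \<inter> U" "X \<inter> {c}"] by auto
qed

lemma distance_star_le_Suc: "distance D X \<le> Suc (card U)"
  using distance_star_le card_mono[OF star_side_conditions(1), of "X \<inter> U"]
  by (cases "c \<in> X") auto

text \<open>The upper bound is attained exactly when no cheaper feasible set exists; a violation of
  any of the four conditions yields a feasible set within distance \<open>card U\<close>.\<close>

lemma distance_star_eq_iff:
  "distance D X = Suc (card U) \<longleftrightarrow> c \<in> X \<and> U \<subseteq> X \<and> B \<inter> U = {} \<and> even (card (X \<inter> B))"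
proof
  assume eq: "distance D X = Suc (card U)"
  have cX: "c \<in> X"
    using distance_star_le card_mono[OF star_side_conditions(1), of "X \<inter> U"] eq
    by (cases "c \<in> X") auto
  have UX: "U \<subseteq> X"
  proof (rule ccontr)
    assume "\<not> U \<subseteq> X"
    then have "card (X \<inter> U) < card U" using star_side_conditions by (intro psubset_card_mono) auto
    then show False using distance_star_le eq cX by auto
  qed
  have BU: "B \<inter> U = {}"
  proof (rule ccontr)
    assume "B \<inter> U \<noteq> {}"
    then obtain u where u: "u \<in> B" "u \<in> U" by blast
    \<comment> \<open>Keeping a single unlooped neighbour \<open>u\<close> of the centre is feasible
      and saves both \<open>u\<close> and \<open>c\<close>.\<close>
    let ?F = "X - (U - {u})"
    have "?F - {c} - W = {u}" using u UX X by (auto simp: U_def)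
    then have "?F \<in> snd D"
      using u cX X star_side_conditions(3) unfolding D_def star_system_def star_feasible_def by auto
    moreover have "sym_diff ?F X = U - {u}" using UX by blast
    then have "card (sym_diff ?F X) \<le> card U" using star_side_conditions by (simp add: card_mono)
    ultimately show False using distance_le[OF finite_snd_star_system] eq by fastforce
  qed
  have "even (card (X \<inter> B))"
  proof (rule ccontr)
    assume odd: "odd (card (X \<inter> B))"
    \<comment> \<open>With an odd number of looped neighbours, the centre need not be
      deleted.\<close>
    let ?F = "X - U"
    have "?F \<inter> B = X \<inter> B" using BU by blast
    moreover have "?F - {c} \<subseteq> W" using X by (auto simp: U_def)
    ultimately have "?F \<in> snd D"
      using odd cX X star_side_conditions(3) unfolding D_def star_system_def star_feasible_def by auto
    moreover have "sym_diff ?F X = U" using UX by blast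
    ultimately show False using distance_le[OF finite_snd_star_system, of ?F X "card U"] eq by simp
  qed
  then show "c \<in> X \<and> U \<subseteq> X \<and> B \<inter> U = {} \<and> even (card (X \<inter> B))" using cX UX BU by blast
next
  assume R: "c \<in> X \<and> U \<subseteq> X \<and> B \<inter> U = {} \<and> even (card (X \<inter> B))"
  have "Suc (card U) \<le> distance D X"
  proof (rule distance_ge[OF finite_snd_star_system])
    show "snd D \<noteq> {}"
      using set_system_star_system[OF fin, of c W B] by (simp add: set_system_def D_def)
    fix F assume "F \<in> snd D"
    then have F: "F \<subseteq> E" "star_feasible c W B F" by (auto simp: D_def star_system_def)
    \<comment> \<open>Every feasible \<open>F\<close> misses all of \<open>U\<close> and differs
      from \<open>X\<close> in one further vertex: \<open>c\<close> itself or, if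
      \<open>c \<in> F\<close>, some vertex of \<open>B\<close>, since \<open>F \<inter> B\<close>
      and \<open>X \<inter> B\<close> have different parities.\<close>
    have "\<exists>w. w \<notin> U \<and> insert w U \<subseteq> sym_diff F X"
    proof (cases "c \<in> F")
      case False
      then have "insert c U \<subseteq> sym_diff F X" using F R by (auto simp: star_feasible_def U_def)
      then show ?thesis using star_side_conditions by blast
    next
      case True
      have "F - {c} - W \<noteq> {u}" if "u \<in> B" for u
        using that R F by (auto simp: U_def)
      then have FW: "F - {c} \<subseteq> W" "odd (card (F \<inter> B))"
        using F True by (auto simp: star_feasible_def)
      then have "F \<inter> B \<noteq> X \<inter> B" using R by auto
      then obtain w where "w \<in> B" "w \<in> sym_diff F X" by blast
      then have "w \<notin> U" "insert w U \<subseteq> sym_diff F X" using R FW by (auto simp: U_def)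
      then show ?thesis by blast
    qed
    then obtain w where w: "w \<notin> U" "insert w U \<subseteq> sym_diff F X" by blast
    have "finite (sym_diff F X)" using F X fin by (auto intro: finite_subset)
    then have "card (insert w U) \<le> card (sym_diff F X)" using w by (intro card_mono)
    then show "Suc (card U) \<le> card (sym_diff F X)" using w star_side_conditions by simp
  qed
  then show "distance D X = Suc (card U)" using distance_star_le_Suc by simp
qed

end

lemma degree_interlace_star_primitive:
  assumes "finite E" "c \<in> E" "c \<notin> W"
  shows "degree (interlace (star_primitive c W E)) = Suc (card (E - {c} - W))"
proof -
  let ?L = "E - {c}" and ?U = "E - {c} - W"
  let ?m = "Suc (card ?U)"
  let ?e = "\<lambda>B. (-1) ^ card (?L - B) :: complex"
  let ?P = "\<lambda>X B. c \<in> X \<and> ?U \<subseteq> X \<and> B \<inter> ?U = {} \<and> even (card (X \<inter> B))"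
  have fin: "finite (Pow ?L)" "finite (Pow E)" using assms(1) by simp_all
  have eq: "interlace (star_primitive c W E)
      = (\<Sum>B\<in>Pow ?L. smult (?e B) (interlace_poly (star_system c W B E)))"
    unfolding star_primitive_def
    by (rule interlace_sum_single[OF fin(1)]) (simp add: set_system_star_system assms(1))
  have "degree (interlace_poly (star_system c W B E)) \<le> ?m" if "B \<subseteq> ?L" for B
    unfolding interlace_poly_def
    by (rule degree_sum_le)
      (use fin distance_star_le_Suc[OF assms(1,2,3) that] in
        \<open>auto simp: degree_monom_eq\<close>)
  then have le: "degree (interlace (star_primitive c W E)) \<le> ?m"
    unfolding eq using fin by (intro degree_sum_le) (auto intro: order_trans[OF degree_smult_le])
  have "coeff (interlace_poly (star_system c W B E)) ?m = (\<Sum>X\<in>Pow E. of_bool (?P X B))"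
    if "B \<subseteq> ?L" for B
    unfolding interlace_poly_def coeff_sum fst_star_system
    by (intro sum.cong refl)
      (simp only: Pow_iff coeff_monom of_bool_def distance_star_eq_iff[OF assms(1,2,3) that])
  then have "coeff (interlace (star_primitive c W E)) ?m
      = (\<Sum>B\<in>Pow ?L. \<Sum>X\<in>Pow E. ?e B * of_bool (?P X B))"
    unfolding eq coeff_sum by (intro sum.cong refl) (simp add: sum_distrib_left)
  also have "\<dots> = (\<Sum>X\<in>Pow E. \<Sum>B\<in>Pow ?L. ?e B * of_bool (?P X B))"
    by (rule sum.swap)
  \<comment> \<open>For \<open>X \<noteq> E\<close> satisfying the conditions that do not involve
    \<open>B\<close>, some leaf \<open>v\<close> lies outside \<open>X\<close>, hence outside
    \<open>?U\<close>. Adding it to \<open>B\<close> changes neither \<open>B \<inter> ?U\<close>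
    nor \<open>X \<inter> B\<close>, so the terms cancel in pairs.\<close>
  also have "\<dots> = (\<Sum>X\<in>{E}. \<Sum>B\<in>Pow ?L. ?e B * of_bool (?P X B))"
  proof (rule sum.mono_neutral_right[OF fin(2)], simp, rule ballI)
    fix X assume "X \<in> Pow E - {E}"
    then have X: "X \<subseteq> E" "X \<noteq> E" by auto
    show "(\<Sum>B\<in>Pow ?L. ?e B * of_bool (?P X B)) = 0"
    proof (cases "c \<in> X \<and> ?U \<subseteq> X")
      case True
      then obtain v where v: "v \<in> ?L" "v \<notin> X" using X by blast
      then have "v \<notin> ?U" using True by blast
      have "?e (insert v B) * of_bool (?P X (insert v B)) = - (?e B * of_bool (?P X B))"
        if "B \<subseteq> ?L - {v}" for B
        using card_Diff_insert_sign[where 'b = complex, of ?L v B] assms(1) v \<open>v \<notin> ?U\<close> that by simp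
      then show ?thesis by (intro sum_Pow_sign_cancel[of _ v]) (use assms(1) v in auto)
    next
      case False
      then have "(of_bool (?P X B) :: complex) = 0" for B by (simp only: of_bool_eq_0_iff) blast
      then show ?thesis by (intro sum.neutral ballI) (simp only: mult_zero_right)
    qed
  qed
  \<comment> \<open>Only even \<open>B\<close> survive, so the sign no longer depends on
    \<open>B\<close> and nothing further cancels.\<close>
  also have "\<dots> = (\<Sum>B\<in>Pow ?L. (-1) ^ card ?L * of_bool (B \<inter> ?U = {} \<and> even (card B)))"
  proof -
    have "?e B * of_bool (?P E B) = (-1) ^ card ?L * of_bool (B \<inter> ?U = {} \<and> even (card B))"
      if "B \<subseteq> ?L" for B
    proof -
      have "finite B" "E \<inter> B = B" using that assms(1) finite_subset[of B E] by auto
      moreover have "card ?L = card (?L - B) + card B"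
        using card_Diff_subset[OF \<open>finite B\<close> that] card_mono[OF _ that] assms(1) by simp
      ultimately show ?thesis using assms(2) by (auto simp: power_add)
    qed
    then show ?thesis by (simp add: Pow_def)
  qed
  also have "\<dots> = (-1) ^ card ?L *
      of_nat (card (Pow ?L \<inter> {B. B \<inter> ?U = {} \<and> even (card B)}))"
    using fin by (simp only: sum_distrib_left[symmetric] sum_of_bool_eq)
  also have "\<dots> \<noteq> 0"
  proof -
    let ?S = "Pow ?L \<inter> {B. B \<inter> ?U = {} \<and> even (card B)}"
    \<comment> \<open>The edgeless star already makes the count positive.\<close>
    have "{} \<in> ?S" by simp
    then have "?S \<noteq> {}" by force
    moreover have "finite ?S" using fin(1) by (rule finite_Int[OF disjI1])
    ultimately have "card ?S \<noteq> 0" by (simp only: card_eq_0_iff simp_thms)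
    then show ?thesis by (simp only: mult_eq_0_iff power_eq_0_iff of_nat_eq_0_iff) simp
  qed
  finally show ?thesis using le le_degree by (metis dual_order.antisym)
qed

text \<open>The earlier polynomials span a subspace of degree at most \<open>n\<close>, which cannot
  contain \<open>f n\<close> of degree \<open>Suc n\<close>.\<close>

lemma independent_distinct_degrees:
  fixes f :: "nat \<Rightarrow> complex poly"
  assumes "\<And>i. i < n \<Longrightarrow> degree (f i) = Suc i"
  shows "poly_space.independent (f ` {..<n})"
  using assms
proof (induction n)
  case 0
  then show ?case by (simp add: poly_space.independent_empty)
next
  case (Suc n)
  have "poly_space.span (f ` {..<n}) \<subseteq> {p. degree p \<le> n}"
  proof (rule poly_space.span_minimal)
    show "f ` {..<n} \<subseteq> {p. degree p \<le> n}" using Suc.prems by force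
    show "poly_space.subspace {p. degree p \<le> n}"
      by (rule poly_space.subspaceI) (auto intro: degree_add_le order_trans[OF degree_smult_le])
  qed
  then have "f n \<notin> poly_space.span (f ` {..<n})" using Suc.prems[of n] by auto
  then show ?case
    using Suc by (simp add: lessThan_Suc poly_space.independent_insertI)
qed

theorem theorem5:
  fixes n :: nat
  assumes "n \<ge> 1"
  shows "(\<exists>S. S \<subseteq> interlace ` {p \<in> graded_part n. primitive p} \<and>
              card S = n \<and> poly_space.independent S)
       \<and> (\<exists>S. S \<subseteq> {interlace (prim_proj D) | D. binary_delta_matroid D \<and> card (fst D) = n} \<and>
              card S = n \<and> poly_space.independent S)"
proof -
  define E where "E = {..<n}"
  \<comment> \<open>Looping the leaves from \<open>Suc m\<close> on leaves \<open>1..m\<close>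
    unlooped, so the interlace polynomial has degree \<open>Suc m\<close>.\<close>
  define p where "p m = star_primitive 0 {Suc m..<n} E" for m
  define S where "S = (\<lambda>m. interlace (p m)) ` {..<n}"
  have E: "finite E" "0 \<in> E" "card E = n" using assms by (auto simp: E_def)
  have deg: "degree (interlace (p m)) = Suc m" if "m < n" for m
  proof -
    have "E - {0} - {Suc m..<n} = {1..m}" using that by (auto simp: E_def)
    then show ?thesis
      using degree_interlace_star_primitive[OF E(1,2), of "{Suc m..<n}"] by (simp add: p_def)
  qed
  have ind: "poly_space.independent S"
    unfolding S_def by (rule independent_distinct_degrees) (rule deg)
  have "inj_on (\<lambda>m. interlace (p m)) {..<n}"
    by (rule inj_onI) (metis deg lessThan_iff nat.inject)
  then have card: "card S = n" by (simp add: S_def card_image)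
  have "p m \<in> graded_part n" "primitive (p m)" for m
    using star_primitive_graded[OF E(1), of 0] primitive_star_primitive[OF E(1,2)] E(3)
    by (auto simp: p_def)
  then have "S \<subseteq> interlace ` {p \<in> graded_part n. primitive p}" by (auto simp: S_def)
  \<comment> \<open>The same \<open>S\<close> serves both claims, because each \<open>p m\<close> is
    the projection of a full star.\<close>
  moreover have "S \<subseteq> {interlace (prim_proj D) | D. binary_delta_matroid D \<and> card (fst D) = n}"
  proof -
    have "p m = prim_proj (star_system 0 {Suc m..<n} (E - {0}) E)" for m
      unfolding p_def by (rule prim_proj_star_system[OF E(1,2), symmetric])
    moreover have "binary_delta_matroid (star_system 0 {Suc m..<n} (E - {0}) E)" for m
      by (rule binary_delta_matroid_star_system[OF E(1)]) auto
    ultimately show ?thesis using E(3) unfolding S_def by fastforce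
  qed
  ultimately show ?thesis using card ind by blast
qed

end
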